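(* Let $n\ge 2$ and let $\Lambda$ be an $(n-1)$-dimensional lattice with Gram matrix $A$ (with respect to some basis of $\Lambda$, $A$ being an $(n-1)\times(n-1)$ positive-definite real symmetric matrix). Then for every $\epsilon>0$ there exist a nonzero vector $v\in\mathbb{Z}^n$, a basis $B$ of the $(n-1)$-dimensional lattice $\Lambda_v$, and a real number $c$ such that, if $A_v$ denotes the Gram matrix of $B$, then $\|A-cA_v\|_\infty<\epsilon$.
   Context: For a nonzero $v\in\mathbb{Z}^n$, let $v^\perp=\{x\in\mathbb{R}^n : x\cdot v=0\}$ and let $\Lambda_v$ denote the orthogonal projection of the cubic lattice $\mathbb{Z}^n$ onto $v^\perp$; it is an $(n-1)$-dimensional lattice. The Gram matrix of a basis $b_1,\dots,b_{n-1}$ is the matrix $(b_i\cdot b_j)_{i,j}$. For a matrix $M$, $\|M\|_\infty=\max_{i,j}|M_{i,j}|$. *)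

theory Defs
  imports "HOL-Analysis.Analysis"
begin

definition lattice_basis :: "('m::finite \<Rightarrow> 'a::real_vector) \<Rightarrow> 'a set \<Rightarrow> bool" where
  "lattice_basis b L \<longleftrightarrow>
     inj b \<and> independent (range b) \<and>
     L = range (\<lambda>k :: 'm \<Rightarrow> int. \<Sum>i\<in>UNIV. of_int (k i) *\<^sub>R b i)"

definition gram_matrix :: "('m::finite \<Rightarrow> 'a::real_inner) \<Rightarrow> real^'m^'m" where
  "gram_matrix b = (\<chi> i j. b i \<bullet> b j)"

definition cubic_lattice :: "(real^'n::finite) set" where
  "cubic_lattice = {x. \<forall>i. x $ i \<in> \<int>}"

definition perp :: "real^'n::finite \<Rightarrow> (real^'n) set" where
  "perp v = {x. x \<bullet> v = 0}"

definition orth_proj :: "'a::euclidean_space set \<Rightarrow> 'a \<Rightarrow> 'a" where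
  "orth_proj S x = (THE y. y \<in> S \<and> (\<forall>z\<in>S. orthogonal (x - y) z))"

definition proj_lattice :: "real^'n::finite \<Rightarrow> (real^'n) set" where
  "proj_lattice v = orth_proj (perp v) ` cubic_lattice"

definition max_norm :: "real^'n::finite^'m::finite \<Rightarrow> real" where
  "max_norm M = Max {\<bar>M $ i $ j\<bar> | i j. True}"

lemma orth_proj_perp:
  fixes v x :: "real^'n::finite"
  assumes "v \<noteq> 0"
  shows "orth_proj (perp v) x = x - ((x \<bullet> v) / (v \<bullet> v)) *\<^sub>R v"
  unfolding orth_proj_def
proof (rule the_equality)
  let ?p = "x - ((x \<bullet> v) / (v \<bullet> v)) *\<^sub>R v"
  have p: "?p \<in> perp v"
    using assms by (simp add: perp_def inner_diff_left)
  show "?p \<in> perp v \<and> (\<forall>z\<in>perp v. orthogonal (x - ?p) z)"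
    using p by (auto simp: perp_def orthogonal_def inner_commute)
  fix y assume y: "y \<in> perp v \<and> (\<forall>z\<in>perp v. orthogonal (x - y) z)"
  have d: "?p - y \<in> perp v"
    using p y by (simp add: perp_def inner_diff_left)
  have "(x - y) \<bullet> (?p - y) = 0"
    using y d by (auto simp: orthogonal_def)
  moreover have "(x - ?p) \<bullet> (?p - y) = 0"
    using d by (simp add: perp_def inner_commute)
  ultimately have "(?p - y) \<bullet> (?p - y) = 0"
    by (simp add: inner_diff_left)
  then show "y = ?p" by simp
qed

lemma max_norm_less_iff:
  fixes M :: "real^'n::finite^'m::finite"
  shows "max_norm M < e \<longleftrightarrow> (\<forall>i j. \<bar>M $ i $ j\<bar> < e)"
proof -
  have eq: "{\<bar>M $ i $ j\<bar> | i j. True} = (\<lambda>(i, j). \<bar>M $ i $ j\<bar>) ` UNIV"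
    by auto
  show ?thesis
    unfolding max_norm_def eq by (subst Max_less_iff) auto
qed

end

theory Submission
  imports Defs
begin

text \<open>
  The dual of \<open>\<Lambda>\<^sub>v\<close> is the lattice of integer vectors orthogonal to \<open>v\<close>, so it suffices to
  approximate the dual Gram matrix \<open>A\<^sup>-\<^sup>1\<close>, up to scaling, by Gram matrices of bases of such
  lattices. Write \<open>A\<^sup>-\<^sup>1 = L L\<^sup>T\<close> with \<open>L\<close> lower triangular, append a zero column to \<open>N L\<close>, round
  its lower triangle down to integers and put \<open>1\<close> on the superdiagonal. Deleting the first column
  leaves a unipotent integer matrix; hence the kernel is spanned by an integer vector \<open>v\<close> with first
  entry \<open>1\<close>, and the rows have a dual basis in \<open>\<Lambda>\<^sub>v\<close>. The Gram matrix of the rows is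
  \<open>N\<^sup>2 A\<^sup>-\<^sup>1 + O(N)\<close>, and that of the dual basis is its inverse.
\<close>

section \<open>Integral forward substitution\<close>

text \<open>Forward substitution for the equations
  \<open>x (Suc i) + (\<Sum>j\<le>i. M i j * x j) = y i\<close>, with \<open>x 0 = c\<close> as free
  parameter. The coefficient 1 of \<open>x (Suc i)\<close> avoids any division, so integrality is
  preserved.\<close>

fun triangular_solution :: "(nat \<Rightarrow> nat \<Rightarrow> real) \<Rightarrow> (nat \<Rightarrow> real) \<Rightarrow> real \<Rightarrow> nat \<Rightarrow> real" where
  "triangular_solution M y c 0 = c"
| "triangular_solution M y c (Suc i) = y i - (\<Sum>j\<le>i. M i j * triangular_solution M y c j)"

lemma triangular_solution_Ints:
  assumes "\<And>i j. i < m \<Longrightarrow> j \<le> i \<Longrightarrow> M i j \<in> \<int>" and "\<And>i. i < m \<Longrightarrow> y i \<in> \<int>" and "c \<in> \<int>"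
  shows "i \<le> m \<Longrightarrow> triangular_solution M y c i \<in> \<int>"
proof (induction i rule: less_induct)
  case (less i)
  then show ?case
    using assms by (cases i) (auto intro!: Ints_diff Ints_sum Ints_mult)
qed

section \<open>Stability of the matrix inverse\<close>

text \<open>Follows from the identity \<open>Y - A = Y ** (D - G) ** A\<close>. It carries closeness
  of the dual Gram matrices over to the Gram matrices themselves.\<close>

lemma exists_inverse_perturbation_bound:
  fixes A D :: "real^'m::finite^'m"
  assumes AD: "A ** D = mat 1" and "\<epsilon> > 0"
  shows "\<exists>\<delta>>0. \<forall>G Y. norm (G - D) < \<delta> \<and> Y ** G = mat 1 \<longrightarrow> norm (Y - A) < \<epsilon>"
proof -
  have bil: "bilinear (\<lambda>(X::real^'m^'m) (Z::real^'m^'m). X ** Z)"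
    unfolding bilinear_def
    by (auto intro!: linearI simp: matrix_matrix_mult_def vec_eq_iff sum.distrib sum_distrib_left
        algebra_simps)
  then have "bounded_bilinear (\<lambda>(X::real^'m^'m) (Z::real^'m^'m). X ** Z)"
    by (simp add: bilinear_conv_bounded_bilinear)
  then obtain K where K: "K > 0"
    "\<And>(X::real^'m^'m) (Z::real^'m^'m). norm (X ** Z) \<le> norm X * norm Z * K"
    using bounded_bilinear.pos_bounded by blast
  define C where "C = K * K * norm A + 1"
  have "C > 0" using K(1) by (simp add: C_def add_nonneg_pos)
  \<comment> \<open>The first bound keeps \<open>norm (G - D) * C\<close> below 1/2, so that
    \<open>norm Y\<close> can be absorbed and is at most \<open>2 * (norm A + 1)\<close>; the second
    then pushes the error below \<open>\<epsilon>\<close>.\<close>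
  define \<delta> where "\<delta> = min (1 / (2 * C)) (\<epsilon> / (2 * C * (norm A + 1)))"
  have "norm A + 1 > 0" by (simp add: add_nonneg_pos)
  have "\<delta> > 0" using \<open>C > 0\<close> \<open>\<epsilon> > 0\<close> \<open>norm A + 1 > 0\<close> by (simp add: \<delta>_def)
  moreover have "norm (Y - A) < \<epsilon>"
    if G: "norm (G - D) < \<delta>" and YG: "Y ** G = mat 1" for G Y :: "real^'m^'m"
  proof -
    have DA: "D ** A = mat 1" using AD matrix_left_right_inverse by blast
    have "Y ** (D - G) ** A = Y ** (D ** A) - (Y ** G) ** A"
      by (simp only: bilinear_rsub[OF bil] bilinear_lsub[OF bil] matrix_mul_assoc)
    then have "Y - A = Y ** (D - G) ** A"
      using DA YG by simp
    also have "norm \<dots> \<le> norm Y * norm (D - G) * K * norm A * K"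
      by (rule order_trans[OF K(2)])
        (intro mult_right_mono K(2) norm_ge_zero less_imp_le[OF K(1)])
    also have "\<dots> = norm Y * norm (G - D) * (K * K * norm A)"
      by (simp add: norm_minus_commute)
    also have "\<dots> \<le> norm Y * norm (G - D) * C"
      by (intro mult_left_mono) (auto simp: C_def)
    finally have le: "norm (Y - A) \<le> norm Y * (norm (G - D) * C)" by simp
    have "norm (G - D) * C \<le> 1 / 2"
      using G \<open>C > 0\<close> by (simp add: \<delta>_def field_simps)
    then have "norm Y * (norm (G - D) * C) \<le> norm Y * (1 / 2)"
      by (intro mult_left_mono) auto
    with le have "norm (Y - A) \<le> norm Y / 2" by simp
    moreover have "norm Y \<le> norm A + norm (Y - A)"
      using norm_triangle_ineq[of A "Y - A"] by simp
    ultimately have "norm Y \<le> 2 * (norm A + 1)" by simp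
    then have "norm Y * (norm (G - D) * C) \<le> 2 * (norm A + 1) * (norm (G - D) * C)"
      using \<open>C > 0\<close> by (intro mult_right_mono) auto
    also have "\<dots> < \<epsilon>"
    proof -
      have "norm (G - D) < \<epsilon> / (2 * C * (norm A + 1))" using G by (simp add: \<delta>_def)
      then have "norm (G - D) * (2 * C * (norm A + 1)) < \<epsilon>"
        using \<open>C > 0\<close> \<open>norm A + 1 > 0\<close> by (subst (asm) pos_less_divide_eq) auto
      then show ?thesis by (simp add: mult_ac)
    qed
    finally show ?thesis using le by linarith
  qed
  ultimately show ?thesis by blast
qed

section \<open>Backward Gram-Schmidt\<close>

lemma exists_triangular_orthonormalization:
  fixes a :: "'m::finite \<Rightarrow> 'a::euclidean_space" and g :: "'m \<Rightarrow> nat"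
  assumes "inj a" and ind: "independent (range a)" and "inj g"
  shows "\<exists>L :: real^'m^'m. (\<forall>i k. g i < g k \<longrightarrow> L $ i $ k = 0) \<and>
           transpose L ** gram_matrix a ** L = mat 1"
proof -
  \<comment> \<open>Gram-Schmidt run from the last vector backwards: expressing the orthonormal vectors in terms
    of \<open>a\<close>, rather than conversely, yields the triangular factor of the inverse Gram matrix.\<close>
  have "\<exists>e c. norm e = 1 \<and> e = (\<Sum>i\<in>UNIV. c i *\<^sub>R a i) \<and> (\<forall>i. g i < g k \<longrightarrow> c i = 0) \<and>
      (\<forall>i. g k < g i \<longrightarrow> e \<bullet> a i = 0)" for k
  proof -
    define S where "S = {i. g k < g i}"
    obtain y z where y: "y \<in> span (a ` S)" and z: "\<And>w. w \<in> span (a ` S) \<Longrightarrow> orthogonal z w"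
      and yz: "a k = y + z"
      using orthogonal_subspace_decomp_exists[of "a ` S" "a k"] by metis
    obtain u where u: "y = (\<Sum>w\<in>a ` S. u w *\<^sub>R w)"
      using y by (auto simp: span_finite)
    have "a k \<notin> span (a ` S)"
    proof -
      have "a ` S \<subseteq> range a - {a k}" using \<open>inj a\<close> by (auto simp: S_def inj_eq)
      then show ?thesis using ind span_mono unfolding dependent_def by blast
    qed
    then have "z \<noteq> 0" using yz y by auto
    \<comment> \<open>Coordinates with respect to \<open>a\<close> of the normalized residual
      \<open>z = a k - y\<close>.\<close>
    define c where "c i = (if i = k then 1 else if i \<in> S then - u (a i) else 0) / norm z" for i
    have "y = (\<Sum>i\<in>S. u (a i) *\<^sub>R a i)"
      unfolding u using \<open>inj a\<close> by (subst sum.reindex) (auto intro: inj_on_subset)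
    also have "\<dots> = (\<Sum>i\<in>UNIV. (if i \<in> S then u (a i) else 0) *\<^sub>R a i)"
      by (intro sum.mono_neutral_cong_left) auto
    finally have ysum: "y = \<dots>" .
    have "(\<Sum>i\<in>UNIV. c i *\<^sub>R a i) =
        (1 / norm z) *\<^sub>R (\<Sum>i\<in>UNIV. (if i = k then 1 else if i \<in> S then - u (a i) else 0) *\<^sub>R a i)"
      by (simp add: c_def scaleR_sum_right)
    also have "(\<Sum>i\<in>UNIV. (if i = k then 1 else if i \<in> S then - u (a i) else 0) *\<^sub>R a i)
        = (\<Sum>i\<in>UNIV. (if i = k then a i else 0) - (if i \<in> S then u (a i) else 0) *\<^sub>R a i)"
      by (intro sum.cong) (auto simp: S_def)
    also have "\<dots> = a k - y" by (simp add: sum_subtractf ysum)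
    finally have "z /\<^sub>R norm z = (\<Sum>i\<in>UNIV. c i *\<^sub>R a i)"
      using yz by (simp add: divide_inverse)
    moreover have "\<forall>i. g i < g k \<longrightarrow> c i = 0" by (auto simp: c_def S_def)
    moreover have "\<forall>i. g k < g i \<longrightarrow> (z /\<^sub>R norm z) \<bullet> a i = 0"
      using z by (auto simp: orthogonal_def S_def intro!: span_base)
    moreover have "norm (z /\<^sub>R norm z) = 1" using \<open>z \<noteq> 0\<close> by simp
    ultimately show ?thesis by blast
  qed
  then obtain e c where norm_e: "\<And>k. norm (e k) = 1"
    and e_sum: "\<And>k. e k = (\<Sum>i\<in>UNIV. c k i *\<^sub>R a i)"
    and c0: "\<And>k i. g i < g k \<Longrightarrow> c k i = 0"
    and ea: "\<And>k i. g k < g i \<Longrightarrow> e k \<bullet> a i = 0"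
    by metis
  \<comment> \<open>Only vectors \<open>a i\<close> with \<open>g i \<ge> g l > g k\<close> occur in
    \<open>e l\<close>, and \<open>e k\<close> is orthogonal to all of them.\<close>
  have lt: "e k \<bullet> e l = 0" if "g k < g l" for k l
  proof -
    have "c l i * (e k \<bullet> a i) = 0" for i
      using c0[of i l] ea[of k i] that by (cases "g i < g l") auto
    then have "(\<Sum>i\<in>UNIV. c l i * (e k \<bullet> a i)) = 0" by (intro sum.neutral) blast
    then show ?thesis by (subst e_sum[of l]) (simp add: inner_sum_right)
  qed
  have ee: "e k \<bullet> e l = (if k = l then 1 else 0)" for k l
    using lt[of k l] lt[of l k] norm_e[of k] \<open>inj g\<close>
    by (auto simp: inner_commute norm_eq_1 inj_eq dest: linorder_neqE_nat)
      (metis injD linorder_neqE_nat)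
  define L :: "real^'m^'m" where "L = (\<chi> i k. c k i)"
  have "(transpose L ** gram_matrix a ** L) $ k $ l = e k \<bullet> e l" for k l
    unfolding e_sum
    by (simp add: matrix_matrix_mult_def transpose_def gram_matrix_def L_def inner_sum_left
        inner_sum_right sum_distrib_right sum_distrib_left algebra_simps)
  then have "transpose L ** gram_matrix a ** L = mat 1"
    by (simp add: vec_eq_iff mat_def ee)
  moreover have "\<forall>i k. g i < g k \<longrightarrow> L $ i $ k = 0" using c0 by (simp add: L_def)
  ultimately show ?thesis by blast
qed

section \<open>Dual bases of projected lattices\<close>

text \<open>The maps \<open>f\<close> and \<open>g\<close> enumerate the columns and rows, making sense of triangularity.\<close>

lemma exists_projection_dual_to_unipotent_rows:
  fixes r :: "'m::finite \<Rightarrow> real^'n::finite" and f :: "'n \<Rightarrow> nat" and g :: "'m \<Rightarrow> nat"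
  assumes f: "bij_betw f UNIV {..m}" and g: "bij_betw g UNIV {..<m}"
    and r_Ints: "\<And>i j. r i $ j \<in> \<int>"
    and r_one: "\<And>i j. f j = Suc (g i) \<Longrightarrow> r i $ j = 1"
    and r_zero: "\<And>i j. Suc (g i) < f j \<Longrightarrow> r i $ j = 0"
  shows "\<exists>(v :: real^'n) (b :: 'm \<Rightarrow> real^'n). v \<in> cubic_lattice \<and> v \<noteq> 0 \<and>
           lattice_basis b (proj_lattice v) \<and> gram_matrix b ** gram_matrix r = mat 1"
proof -
  define f' where "f' = inv_into UNIV f"
  define g' where "g' = inv_into UNIV g"
  have f'f: "f' (f j) = j" for j using f by (simp add: f'_def bij_betw_def)
  have ff': "f (f' q) = q" if "q \<le> m" for q
    using f that by (auto simp: f'_def bij_betw_def intro: f_inv_into_f)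
  have g'g: "g' (g i) = i" for i using g by (simp add: g'_def bij_betw_def)
  have gm: "g i < m" for i using g by (auto simp: bij_betw_def)
  have fm: "f j \<le> m" for j using f by (auto simp: bij_betw_def)
  \<comment> \<open>The last nonzero entry of row \<open>i\<close> is the 1 in column
    \<open>Suc (g i)\<close>, so \<open>r i \<bullet> x\<close> and the earlier coordinates of
    \<open>x\<close> determine the coordinate there.\<close>
  have row: "r i \<bullet> x = x $ f' (Suc (g i)) + (\<Sum>q\<le>g i. r i $ f' q * x $ f' q)" for i x
  proof -
    have "r i \<bullet> x = (\<Sum>j\<in>UNIV. r i $ f' (f j) * x $ f' (f j))"
      by (simp add: inner_vec_def f'f)
    also have "\<dots> = (\<Sum>q\<le>m. r i $ f' q * x $ f' q)"
      by (rule sum.reindex_bij_betw[OF f])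
    also have "\<dots> = (\<Sum>q\<le>Suc (g i). r i $ f' q * x $ f' q)"
      using gm[of i] by (intro sum.mono_neutral_right) (auto simp: r_zero ff')
    also have "\<dots> = x $ f' (Suc (g i)) + (\<Sum>q\<le>g i. r i $ f' q * x $ f' q)"
      using gm[of i] by (simp add: r_one ff')
    finally show ?thesis .
  qed
  \<comment> \<open>Induction along the columns: coordinate 0 determines a kernel vector, so the
    kernel is at most a line.\<close>
  have unique: "x = 0" if rx: "\<And>i. r i \<bullet> x = 0" and x0: "x $ f' 0 = 0" for x
  proof -
    have "x $ f' q = 0" if "q \<le> m" for q
      using that
    proof (induction q rule: less_induct)
      case (less q)
      show ?case
      proof (cases q)
        case 0
        then show ?thesis using x0 by simp
      next
        case (Suc p)
        then obtain i where i: "g i = p"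
          using less.prems g by (auto simp: bij_betw_def image_iff Suc_le_eq) (metis lessThan_iff rangeE)
        have "(\<Sum>q\<le>p. r i $ f' q * x $ f' q) = 0"
          using less Suc by (intro sum.neutral) auto
        then show ?thesis using row[of i x] rx[of i] i Suc by simp
      qed
    qed
    then show ?thesis by (metis f'f fm vec_eq_iff zero_index)
  qed
  \<comment> \<open>Existence over the integers: coordinate 0 and the right-hand sides can be
    prescribed freely.\<close>
  have solve: "\<exists>x \<in> cubic_lattice. x $ f' 0 = c \<and> (\<forall>i. r i \<bullet> x = y i)"
    if c: "c \<in> \<int>" and y: "\<And>i. y i \<in> \<int>" for c and y :: "'m \<Rightarrow> real"
  proof -
    define s where "s = triangular_solution (\<lambda>p q. r (g' p) $ f' q) (\<lambda>p. y (g' p)) c"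
    define x :: "real^'n" where "x = (\<chi> j. s (f j))"
    have "s q \<in> \<int>" if "q \<le> m" for q
      unfolding s_def using that by (rule triangular_solution_Ints[rotated 3]) (auto simp: r_Ints c y)
    then have "x \<in> cubic_lattice" by (simp add: cubic_lattice_def x_def fm)
    moreover have xs: "x $ f' q = s q" if "q \<le> m" for q using that by (simp add: x_def ff')
    have "r i \<bullet> x = y i" for i
    proof -
      have "(\<Sum>q\<le>g i. r i $ f' q * x $ f' q) = (\<Sum>q\<le>g i. r i $ f' q * s q)"
        using gm[of i] by (intro sum.cong) (auto simp: xs)
      moreover have "x $ f' (Suc (g i)) = y i - (\<Sum>q\<le>g i. r i $ f' q * s q)"
        using gm[of i] by (subst xs) (auto simp: s_def g'g)
      ultimately show ?thesis by (simp add: row)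
    qed
    moreover have "x $ f' 0 = c" by (simp add: xs s_def)
    ultimately show ?thesis by blast
  qed
  obtain v where v: "v \<in> cubic_lattice" "v $ f' 0 = 1" "\<And>i. r i \<bullet> v = 0"
    using solve[of 1 "\<lambda>_. 0"] by auto
  have "v \<noteq> 0" using v(2) by auto
  \<comment> \<open>Integer vectors dual to the rows. The rows are orthogonal to \<open>v\<close>,
    so projecting along \<open>v\<close> keeps these pairings; the projections will form the basis
    \<open>b\<close>.\<close>
  have "\<forall>j. \<exists>x \<in> cubic_lattice. x $ f' 0 = 0 \<and> (\<forall>i. r i \<bullet> x = (if i = j then 1 else 0))"
    by (intro allI solve) auto
  then obtain x where x: "\<And>j. x j \<in> cubic_lattice"
    "\<And>i j. r i \<bullet> x j = (if i = j then 1 else 0)"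
    by metis
  define P where "P z = z - ((z \<bullet> v) / (v \<bullet> v)) *\<^sub>R v" for z
  have P: "orth_proj (perp v) = P"
    using orth_proj_perp[OF \<open>v \<noteq> 0\<close>] by (auto simp: P_def)
  have P_linear: "linear P"
    by (auto intro!: linearI simp: P_def algebra_simps add_divide_distrib inner_add_left)
  have Pv: "P v = 0" using \<open>v \<noteq> 0\<close> by (simp add: P_def)
  have rP: "r i \<bullet> P z = r i \<bullet> z" for i z by (simp add: P_def inner_diff_right v(3))
  have P_perp: "P z \<bullet> v = 0" for z using \<open>v \<noteq> 0\<close> by (simp add: P_def inner_diff_left)
  define b where "b j = P (x j)" for j
  have rb: "r i \<bullet> b j = (if i = j then 1 else 0)" for i j by (simp add: b_def rP x)
  have P_sum: "P z = (\<Sum>j\<in>UNIV. (r j \<bullet> z) *\<^sub>R b j)" for z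
  proof -
    \<comment> \<open>All rows annihilate \<open>w\<close>, so by \<open>unique\<close> it is a
      multiple of \<open>v\<close>, and \<open>P\<close> kills it.\<close>
    define w where "w = z - (\<Sum>j\<in>UNIV. (r j \<bullet> z) *\<^sub>R x j)"
    have rw: "r i \<bullet> w = 0" for i
      by (simp add: w_def inner_diff_right inner_sum_right x if_distrib cong: if_cong)
    have "w - (w $ f' 0) *\<^sub>R v = 0"
      by (rule unique) (simp_all add: inner_diff_right rw v)
    then have "P w = 0" using linear_scale[OF P_linear, of "w $ f' 0" v] Pv by simp
    then show ?thesis
      by (simp add: w_def linear_diff[OF P_linear] linear_sum[OF P_linear]
          linear_scale[OF P_linear] b_def)
  qed
  have r_sum: "r j \<bullet> (\<Sum>i\<in>UNIV. k i *\<^sub>R b i) = k j" for j and k :: "'m \<Rightarrow> real"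
    by (simp add: inner_sum_right rb if_distrib cong: if_cong)
  have "inj b" by (metis injI rb zero_neq_one)
  moreover have "independent (range b)"
  proof -
    have "k (b j) = 0" if "(\<Sum>w\<in>range b. k w *\<^sub>R w) = 0" for k j
    proof -
      have "(\<Sum>i\<in>UNIV. k (b i) *\<^sub>R b i) = 0"
        using that \<open>inj b\<close> by (simp add: sum.reindex)
      then show ?thesis using r_sum[of j "\<lambda>i. k (b i)"] by simp
    qed
    then show ?thesis by (auto simp: independent_explicit)
  qed
  moreover have "proj_lattice v = range (\<lambda>k :: 'm \<Rightarrow> int. \<Sum>i\<in>UNIV. of_int (k i) *\<^sub>R b i)"
  proof (intro equalityI subsetI)
    fix w assume "w \<in> proj_lattice v"
    then obtain z where z: "z \<in> cubic_lattice" "w = P z" by (auto simp: proj_lattice_def P)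
    \<comment> \<open>By \<open>P_sum\<close> these are the coordinates of \<open>P z\<close> in
      \<open>b\<close>; they are pairings of two integer vectors.\<close>
    have "r j \<bullet> z \<in> \<int>" for j
      using z(1) r_Ints by (auto simp: inner_vec_def cubic_lattice_def intro!: Ints_sum Ints_mult)
    then have "w = (\<Sum>i\<in>UNIV. of_int \<lfloor>r i \<bullet> z\<rfloor> *\<^sub>R b i)"
      by (simp add: z(2) P_sum)
    then show "w \<in> range (\<lambda>k :: 'm \<Rightarrow> int. \<Sum>i\<in>UNIV. of_int (k i) *\<^sub>R b i)"
      by (rule range_eqI[where x = "\<lambda>i. \<lfloor>r i \<bullet> z\<rfloor>"])
  next
    fix w assume "w \<in> range (\<lambda>k :: 'm \<Rightarrow> int. \<Sum>i\<in>UNIV. of_int (k i) *\<^sub>R b i)"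
    then obtain k :: "'m \<Rightarrow> int" where "w = (\<Sum>i\<in>UNIV. of_int (k i) *\<^sub>R b i)" by blast
    then have "w = P (\<Sum>i\<in>UNIV. of_int (k i) *\<^sub>R x i)"
      by (simp add: linear_sum[OF P_linear] linear_scale[OF P_linear] b_def)
    moreover have "(\<Sum>i\<in>UNIV. of_int (k i) *\<^sub>R x i) \<in> cubic_lattice"
      using x(1) by (auto simp: cubic_lattice_def intro!: Ints_sum Ints_mult)
    ultimately show "w \<in> proj_lattice v" by (auto simp: proj_lattice_def P)
  qed
  ultimately have "lattice_basis b (proj_lattice v)" by (simp add: lattice_basis_def)
  moreover have "gram_matrix b ** gram_matrix r = mat 1"
  proof -
    \<comment> \<open>Pairing this expansion with \<open>r j\<close> gives the matrix identity. Its
      defect \<open>d\<close> lies in \<open>perp v\<close> and is orthogonal to every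
      \<open>b j\<close>, hence to \<open>P d = d\<close>, and so vanishes.\<close>
    have "b i = (\<Sum>k\<in>UNIV. (b i \<bullet> b k) *\<^sub>R r k)" for i
    proof -
      define d where "d = b i - (\<Sum>k\<in>UNIV. (b i \<bullet> b k) *\<^sub>R r k)"
      have "d \<bullet> v = 0" by (simp add: d_def inner_diff_left inner_sum_left v(3) b_def P_perp)
      moreover have "d \<bullet> b j = 0" for j
        by (simp add: d_def inner_diff_left inner_sum_left rb if_distrib cong: if_cong)
      then have "d \<bullet> P d = 0" by (subst P_sum) (simp add: inner_sum_right)
      ultimately have "d = 0" by (simp add: P_def)
      then show ?thesis by (simp add: d_def)
    qed
    then have "b i \<bullet> r j = (\<Sum>k\<in>UNIV. (b i \<bullet> b k) *\<^sub>R r k) \<bullet> r j" for i j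
      by (rule arg_cong)
    then have "(\<Sum>k\<in>UNIV. (b i \<bullet> b k) * (r k \<bullet> r j)) = b i \<bullet> r j" for i j
      by (simp only: inner_sum_left inner_scaleR_left)
    then show ?thesis
      by (simp add: matrix_matrix_mult_def gram_matrix_def vec_eq_iff mat_def rb
          inner_commute[of "b _" "r _"])
  qed
  ultimately show ?thesis using v(1) \<open>v \<noteq> 0\<close> by blast
qed

section \<open>Approximation by rounding\<close>

lemma floor_mult_over_tendsto:
  fixes x :: real
  shows "(\<lambda>N. of_int \<lfloor>real N * x\<rfloor> / real N) \<longlonglongrightarrow> x"
proof (rule Lim_null_comparison[THEN LIM_zero_cancel])
  show "\<forall>\<^sub>F N in sequentially. norm (of_int \<lfloor>real N * x\<rfloor> / real N - x) \<le> 1 / real N"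
  proof (rule eventually_sequentiallyI[of 1])
    fix N :: nat assume "1 \<le> N"
    then have "of_int \<lfloor>real N * x\<rfloor> / real N - x = (of_int \<lfloor>real N * x\<rfloor> - real N * x) / real N"
      by (simp add: field_simps)
    moreover have "\<bar>of_int \<lfloor>real N * x\<rfloor> - real N * x\<bar> \<le> 1" by linarith
    ultimately show "norm (of_int \<lfloor>real N * x\<rfloor> / real N - x) \<le> 1 / real N"
      by (simp add: abs_divide divide_right_mono)
  qed
  show "(\<lambda>N. 1 / real N) \<longlonglongrightarrow> 0" by (rule lim_1_over_n)
qed

theorem theorem1:
  fixes \<Lambda> :: "'a::euclidean_space set"
    and a :: "'m::finite \<Rightarrow> 'a"
    and A :: "real^'m^'m"
    and \<epsilon> :: real
  assumes "CARD('n::finite) \<ge> 2"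
    and "CARD('m) = CARD('n) - 1"
    and "lattice_basis a \<Lambda>"
    and "A = gram_matrix a"
    and "\<epsilon> > 0"
  shows "\<exists>(v :: real^'n) (b :: 'm \<Rightarrow> real^'n) (c :: real).
           v \<in> cubic_lattice \<and> v \<noteq> 0 \<and> lattice_basis b (proj_lattice v) \<and>
           max_norm (A - c *\<^sub>R gram_matrix b) < \<epsilon>"
proof -
  define m where "m = CARD('m)"
  obtain g :: "'m \<Rightarrow> nat" where g: "bij_betw g UNIV {..<m}"
    using ex_bij_betw_finite_nat[of "UNIV :: 'm set"] by (auto simp: m_def atLeast0LessThan)
  obtain f :: "'n \<Rightarrow> nat" where f: "bij_betw f UNIV {..m}"
  proof -
    \<comment> \<open>Columns are numbered 0 to \<open>m\<close>, rows only 0 to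
      \<open>m - 1\<close>; column \<open>m\<close> is the appended one.\<close>
    have "{0..<CARD('n)} = {..m}" using assms(1,2) by (auto simp: m_def)
    then show ?thesis using ex_bij_betw_finite_nat[of "UNIV :: 'n set"] that by auto
  qed
  define g' where "g' = inv_into UNIV g"
  have g'g: "g' (g i) = i" for i using g by (simp add: g'_def bij_betw_def)
  have gm: "g i < m" for i using g by (auto simp: bij_betw_def)
  obtain L :: "real^'m^'m" where L0: "\<And>i k. g i < g k \<Longrightarrow> L $ i $ k = 0"
    and L1: "transpose L ** A ** L = mat 1"
    using exists_triangular_orthonormalization[of a g] g assms(3,4)
    by (auto simp: lattice_basis_def bij_betw_def)
  define D where "D = L ** transpose L"
  \<comment> \<open>\<open>transpose L\<close> is a left inverse of the square matrix
    \<open>A ** L\<close>, hence also a right inverse.\<close>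
  have AD: "A ** D = mat 1"
    using L1 unfolding D_def by (metis matrix_left_right_inverse matrix_mul_assoc)
  obtain \<delta> where "\<delta> > 0"
    and \<delta>: "\<And>G Y. norm (G - D) < \<delta> \<Longrightarrow> Y ** G = mat 1 \<Longrightarrow> norm (Y - A) < \<epsilon>"
    using exists_inverse_perturbation_bound[OF AD \<open>\<epsilon> > 0\<close>] by metis
  \<comment> \<open>\<open>g'\<close> reads a column number as an index of \<open>L\<close>, valid
    since \<open>f j \<le> g i < m\<close>. The entry 1 on the superdiagonal does not grow with
    \<open>N\<close>, so it disappears in the limit \<open>R\<close>.\<close>
  define r :: "nat \<Rightarrow> 'm \<Rightarrow> real^'n" where
    "r N i = (\<chi> j. if f j \<le> g i then of_int \<lfloor>real N * L $ i $ g' (f j)\<rfloor>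
                   else if f j = Suc (g i) then 1 else 0)" for N i
  define R :: "'m \<Rightarrow> real^'n" where
    "R i = (\<chi> j. if f j \<le> g i then L $ i $ g' (f j) else 0)" for i
  have r_lim: "(\<lambda>N. r N i /\<^sub>R real N) \<longlonglongrightarrow> R i" for i
  proof (rule vec_tendstoI)
    fix j
    show "(\<lambda>N. (r N i /\<^sub>R real N) $ j) \<longlonglongrightarrow> R i $ j"
      using floor_mult_over_tendsto[of "L $ i $ g' (f j)"] lim_1_over_n[where 'a = real]
      by (simp add: r_def R_def divide_inverse mult.commute)
  qed
  have D: "D = gram_matrix R"
  proof -
    have "R i \<bullet> R k = (\<Sum>l\<in>UNIV. L $ i $ l * L $ k $ l)" for i k
    proof -
      define F where "F q = (if q \<le> g i then L $ i $ g' q else 0) *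
        (if q \<le> g k then L $ k $ g' q else 0)" for q
      have "R i \<bullet> R k = (\<Sum>j\<in>UNIV. F (f j))"
        by (simp add: inner_vec_def R_def F_def)
      also have "\<dots> = (\<Sum>q\<le>m. F q)" by (rule sum.reindex_bij_betw[OF f])
      also have "\<dots> = (\<Sum>q<m. F q)"
        using gm[of i] by (intro sum.mono_neutral_right) (auto simp: F_def)
      also have "\<dots> = (\<Sum>l\<in>UNIV. F (g l))" by (rule sum.reindex_bij_betw[OF g, symmetric])
      \<comment> \<open>Where the conditions in \<open>F\<close> cut off, the entries of
        \<open>L\<close> are already zero by \<open>L0\<close>.\<close>
      also have "\<dots> = (\<Sum>l\<in>UNIV. L $ i $ l * L $ k $ l)"
        by (intro sum.cong) (auto simp: F_def g'g L0)
      finally show ?thesis .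
    qed
    then show ?thesis
      by (simp add: D_def matrix_matrix_mult_def transpose_def gram_matrix_def vec_eq_iff)
  qed
  have "(\<lambda>N. gram_matrix (\<lambda>i. r N i /\<^sub>R real N)) \<longlonglongrightarrow> D"
    unfolding D gram_matrix_def
    by (intro vec_tendstoI)
      (auto simp del: inner_scaleR_left inner_scaleR_right intro!: tendsto_inner r_lim)
  then have "\<forall>\<^sub>F N in sequentially. norm (gram_matrix (\<lambda>i. r N i /\<^sub>R real N) - D) < \<delta>"
    using \<open>\<delta> > 0\<close> by (simp add: tendsto_iff dist_norm)
  then have "\<forall>\<^sub>F N in sequentially. norm (gram_matrix (\<lambda>i. r N i /\<^sub>R real N) - D) < \<delta> \<and> 0 < N"
    using eventually_gt_at_top eventually_conj by blast
  then obtain N where N: "norm (gram_matrix (\<lambda>i. r N i /\<^sub>R real N) - D) < \<delta>" "0 < N"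
    by (auto simp: eventually_sequentially)
  obtain v :: "real^'n" and b :: "'m \<Rightarrow> real^'n" where v: "v \<in> cubic_lattice" "v \<noteq> 0"
    and b: "lattice_basis b (proj_lattice v)" and br: "gram_matrix b ** gram_matrix (r N) = mat 1"
  proof -
    have "r N i $ j \<in> \<int>" for i j by (simp add: r_def)
    moreover have "r N i $ j = 1" if "f j = Suc (g i)" for i j using that by (simp add: r_def)
    moreover have "r N i $ j = 0" if "Suc (g i) < f j" for i j using that by (simp add: r_def)
    ultimately show ?thesis
      using exists_projection_dual_to_unipotent_rows[OF f g, of "r N"] that by blast
  qed
  \<comment> \<open>Dividing the rows by \<open>N\<close> divides their Gram matrix by
    \<open>N^2\<close>, so its inverse is \<open>N^2\<close> times that of the dual basis; this is
    the scalar \<open>c\<close>.\<close>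
  define Y where "Y = (real N)\<^sup>2 *\<^sub>R gram_matrix b"
  have "Y ** gram_matrix (\<lambda>i. r N i /\<^sub>R real N) = gram_matrix b ** gram_matrix (r N)"
    using N(2)
    by (simp add: Y_def matrix_matrix_mult_def gram_matrix_def vec_eq_iff
        power2_eq_square field_simps)
  then have "norm (Y - A) < \<epsilon>" using \<delta>[OF N(1)] br by simp
  moreover have "\<bar>(A - Y) $ i $ j\<bar> \<le> norm (Y - A)" for i j
    using component_le_norm_cart[of "(A - Y) $ i" j]
      Finite_Cartesian_Product.norm_nth_le[of "A - Y" i]
    by (simp only: norm_minus_commute[of Y A])
  ultimately have "max_norm (A - Y) < \<epsilon>" unfolding max_norm_less_iff by (meson le_less_trans)
  then show ?thesis using v b unfolding Y_def by blast
qed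

end
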